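(* Let $S \subset I$ be a subset of the index set of simple roots and let $\mathsf{P}_1$ be the matrix with entries $(\mathsf{P}_1)^i_j = p^i_j = u^i_1 (u^j_1)^* \in \mathbb{C}_q[U/K_S]$, where $u^i_j$ are the unitary matrix coefficients of the irreducible $U_q(\mathfrak{u})$-representation $V(\rho_S)$ with respect to an orthonormal weight basis $\{v_i\}_{i=1}^N$ whose first vector $v_1$ is a highest weight vector, and let $$C(\mathsf{P}_1) = \sum_{i,j,k=1}^N q^{(2\rho,\lambda_i)} \,(2 p^i_j - \delta^i_j) \otimes p^j_k \otimes p^k_i \in \mathbb{C}_q[U/K_S]^{\otimes 3}.$$ Then the class $[C(\mathsf{P}_1)] \in HH^\theta_2\big(\mathbb{C}_q[U/K_S]\big)$ in twisted Hochschild homology, with twist $\theta$ the modular automorphism of the Haar state, is non-trivial (i.e. non-zero).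
   Context: Lie data. $\mathfrak{g}$ is a complex simple Lie algebra with Cartan subalgebra $\mathfrak{h}$, simple roots $\{\alpha_i : i\in I\}$, fundamental weights $\{\omega_i : i \in I\}$, and bilinear form $(\cdot,\cdot)$ on $\mathfrak{h}^*$ obtained from the Killing form and rescaled so that $(\alpha,\alpha)=2$ for short roots. $\rho$ is the half-sum of the positive roots. For $S\subset I$ put $\rho_S := \sum_{i\in I\setminus S}\omega_i$. $U$ is the connected simply connected compact Lie group of the compact real form $\mathfrak u$ of $\mathfrak g$. Quantized enveloping algebra. Fix $0<q<1$, $q_i = q^{(\alpha_i,\alpha_i)/2}$. $U_q(\mathfrak{g})$ is the Hopf algebra generated by $K_i^{\pm1},E_i,F_i$ ($i\in I$) with the $K_i$ commuting, $K_iE_jK_i^{-1}=q^{(\alpha_i,\alpha_j)}E_j$, $K_iF_jK_i^{-1}=q^{-(\alpha_i,\alpha_j)}F_j$, $[E_i,F_j]=\delta_{ij}\frac{K_i-K_i^{-1}}{q_i-q_i^{-1}}$ and the quantum Serre relations; $\Delta(K_i)=K_i\otimes K_i$, $\Delta(E_i)=E_i\otimes K_i+1\otimes E_i$, $\Delta(F_i)=F_i\otimes 1+K_i^{-1}\otimes F_i$, $S(K_i)=K_i^{-1}$, $S(E_i)=-E_iK_i^{-1}$, $S(F_i)=-K_iF_i$, $\varepsilon(K_i)=1$, $\varepsilon(E_i)=\varepsilon(F_i)=0$. For $\lambda=\sum n_i\alpha_i$, $K_\lambda=\prod K_i^{n_i}$. $U_q(\mathfrak{u})$ denotes $U_q(\mathfrak{g})$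 with the $*$-structure $K_i^*=K_i$, $E_i^*=K_iF_i$, $F_i^*=E_iK_i^{-1}$. $U_q(\mathfrak{k}_S)$ is the Hopf $*$-subalgebra generated by $K_i^{\pm 1}$ ($i\in I$) and $E_j,F_j$ ($j\in S$). For a dominant weight $\lambda$, $V(\lambda)$ is the irreducible highest weight module ($K_i$ acts on weight $\mu$ vectors by $q^{(\mu,\alpha_i)}$); it carries an inner product (linear in the second slot), unique up to scale, which is $U_q(\mathfrak{u})$-invariant: $(Xv,w)=(v,X^*w)$. Quantized coordinate ring. $\mathbb{C}_q[U]\subset U_q(\mathfrak{g})^*$ is the span of the matrix coefficients $X\mapsto f(Xv)$ of the modules $V(\lambda)$, a Hopf $*$-algebra by $(ab)(X)=(a\otimes b)\Delta(X)$, $\Delta(a)(X\otimes Y)=a(XY)$, $S(a)(X)=a(S(X))$, $1(X)=\varepsilon(X)$, $\varepsilon(a)=a(1)$, $a^*(X)=\overline{a(S(X)^* )}$. Actions: $(X\triangleright a)(Y)=a(YX)$, $(a\triangleleft X)(Y)=a(XY)$. The quantum flag manifold is $\mathbb{C}_q[U/K_S]=\{a\in\mathbb{C}_q[U] : X\triangleright a=\varepsilon(X)a\ \forall X\in U_q(\mathfrak{k}_S)\}$. The modular automorphism $\theta$ of the Haar state $h$ (characterized by $h(ab)=h(b\theta(a))$) is $\theta(a)=K_{2\rho}\triangleright a\triangleleft K_{2\rho}$; it restricts to $\mathbb{C}_q[U/K_S]$. Matrix coefficients. $\{v_i\}_{i=1}^N$ is an orthonormal weight basis of $V(\rho_S)$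 for an invariant inner product, $v_i$ has weight $\lambda_i$, $v_1$ is a highest weight vector (so $\lambda_1=\rho_S$), and $u^i_j(X)=(v_i,Xv_j)$. The elements $p^i_j=u^i_1(u^j_1)^*$ lie in $\mathbb{C}_q[U/K_S]$. Twisted Hochschild homology. For an algebra $A$ and $\sigma\in\mathrm{Aut}(A)$, ${}_\sigma A$ is $A$ with bimodule structure $a\cdot b\cdot c=\sigma(a)bc$, and $HH^\sigma_\bullet(A)=H_\bullet(A,{}_\sigma A)$ is Hochschild homology with coefficients in ${}_\sigma A$, computed by $C_n={}_\sigma A\otimes A^{\otimes n}$ with $\mathrm{b}(m\otimes a_1\otimes\cdots\otimes a_n)=ma_1\otimes a_2\otimes\cdots\otimes a_n+\sum_{i=1}^{n-1}(-1)^i m\otimes\cdots\otimes a_ia_{i+1}\otimes\cdots\otimes a_n+(-1)^n\sigma(a_n)m\otimes a_1\otimes\cdots\otimes a_{n-1}$, or equivalently by the normalized complex ${}_\sigma A\otimes(A/\mathbb{C}1)^{\otimes n}$. The element $C(\mathsf{P}_1)$ is a 2-cycle in the normalized complex with $\sigma=\theta$, hence defines a class in $HH_2^\theta(\mathbb{C}_q[U/K_S])$.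
   Formalization: The subset S of I is required to be proper; for S = I one has ρ_S = 0, V(ρ_S) is trivial and C(P_1) = 1⊗1⊗1 vanishes in the normalized complex, so the claim fails there. *)

theory Defs
  imports
    "HOL-Analysis.Euclidean_Space"
    "HOL-Library.Poly_Mapping"
    "HOL-Library.Product_Plus"
    "HOL-Algebra.Coset"
    "HOL-Algebra.Module"
    "Jordan_Normal_Form.Matrix"
begin

section \<open>Lie data\<close>

text \<open>
  A complex simple Lie algebra with a Cartan subalgebra and a choice of simple roots enters only
  through its root system. The Euclidean space \<open>'a\<close> is the real span of the roots in the dual of the
  Cartan subalgebra, and its inner product is the restriction of the rescaled form \<open>(\<cdot>,\<cdot>)\<close>; the
  simple roots are a family \<open>\<alpha>\<close> indexed by the finite type \<open>'i\<close>, which plays the role of \<open>I\<close>.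
\<close>

definition irreducible_root_system :: "'a::euclidean_space set \<Rightarrow> bool" where
  "irreducible_root_system \<Phi> \<longleftrightarrow>
     finite \<Phi> \<and> 0 \<notin> \<Phi> \<and> span \<Phi> = UNIV \<and>
     (\<forall>\<beta>\<in>\<Phi>. \<forall>c::real. c *\<^sub>R \<beta> \<in> \<Phi> \<longleftrightarrow> c = 1 \<or> c = -1) \<and>
     (\<forall>\<beta>\<in>\<Phi>. \<forall>\<gamma>\<in>\<Phi>. \<gamma> - (2 * inner \<gamma> \<beta> / inner \<beta> \<beta>) *\<^sub>R \<beta> \<in> \<Phi>) \<and>
     (\<forall>\<beta>\<in>\<Phi>. \<forall>\<gamma>\<in>\<Phi>. 2 * inner \<gamma> \<beta> / inner \<beta> \<beta> \<in> \<int>) \<and>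
     (\<forall>\<Psi>\<subseteq>\<Phi>. (\<forall>\<beta>\<in>\<Psi>. \<forall>\<gamma>\<in>\<Phi> - \<Psi>. inner \<beta> \<gamma> = 0) \<longrightarrow> \<Psi> = {} \<or> \<Psi> = \<Phi>)"

definition positive_roots :: "'a::euclidean_space set \<Rightarrow> ('i::finite \<Rightarrow> 'a) \<Rightarrow> 'a set" where
  "positive_roots \<Phi> \<alpha> = {\<beta> \<in> \<Phi>. \<exists>n::'i \<Rightarrow> nat. \<beta> = (\<Sum>i\<in>UNIV. real (n i) *\<^sub>R \<alpha> i)}"

definition simple_lie_data :: "'a::euclidean_space set \<Rightarrow> ('i::finite \<Rightarrow> 'a) \<Rightarrow> bool" where
  "simple_lie_data \<Phi> \<alpha> \<longleftrightarrow>
     irreducible_root_system \<Phi> \<and>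
     inj \<alpha> \<and> range \<alpha> \<subseteq> \<Phi> \<and> independent (range \<alpha>) \<and>
     (\<forall>\<beta>\<in>\<Phi>. \<beta> \<in> positive_roots \<Phi> \<alpha> \<or> - \<beta> \<in> positive_roots \<Phi> \<alpha>) \<and>
     Min ((\<lambda>\<beta>. inner \<beta> \<beta>) ` \<Phi>) = 2"

definition rho :: "'a::euclidean_space set \<Rightarrow> ('i::finite \<Rightarrow> 'a) \<Rightarrow> 'a" where
  "rho \<Phi> \<alpha> = (1/2) *\<^sub>R (\<Sum>\<beta>\<in>positive_roots \<Phi> \<alpha>. \<beta>)"

definition fundamental_weight :: "('i::finite \<Rightarrow> 'a::euclidean_space) \<Rightarrow> 'i \<Rightarrow> 'a" where
  "fundamental_weight \<alpha> i =
     (THE w. \<forall>j. 2 * inner w (\<alpha> j) / inner (\<alpha> j) (\<alpha> j) = (if i = j then 1 else 0))"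

definition dominant_weight :: "('i::finite \<Rightarrow> 'a::euclidean_space) \<Rightarrow> 'a \<Rightarrow> bool" where
  "dominant_weight \<alpha> w \<longleftrightarrow> (\<forall>i. 2 * inner w (\<alpha> i) / inner (\<alpha> i) (\<alpha> i) \<in> \<nat>)"

definition rho_sub :: "('i::finite \<Rightarrow> 'a::euclidean_space) \<Rightarrow> 'i set \<Rightarrow> 'a" where
  "rho_sub \<alpha> S = (\<Sum>i\<in>- S. fundamental_weight \<alpha> i)"

definition cartan_entry :: "('i::finite \<Rightarrow> 'a::euclidean_space) \<Rightarrow> 'i \<Rightarrow> 'i \<Rightarrow> int" where
  "cartan_entry \<alpha> i j = \<lfloor>2 * inner (\<alpha> i) (\<alpha> j) / inner (\<alpha> i) (\<alpha> i)\<rfloor>"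

section \<open>The free algebra on the generators\<close>

text \<open>
  Words form a monoid, written additively so that the finitely supported functions on words are
  the free algebra (with convolution as product), and those on pairs of words its tensor square.
\<close>

datatype 'g word = Word (letters: "'g list")

instantiation word :: (type) monoid_add
begin
definition zero_word :: "'a word" where "zero_word = Word []"
definition plus_word :: "'a word \<Rightarrow> 'a word \<Rightarrow> 'a word" where
  "plus_word v w = Word (letters v @ letters w)"
instance
  by standard (auto simp: zero_word_def plus_word_def)
end

datatype 'i gen = GenK 'i | GenKinv 'i | GenE 'i | GenF 'i

type_synonym 'i free_alg = "'i gen word \<Rightarrow>\<^sub>0 complex"
type_synonym 'i free_alg2 = "('i gen word \<times> 'i gen word) \<Rightarrow>\<^sub>0 complex"

definition pscale :: "complex \<Rightarrow> ('k \<Rightarrow>\<^sub>0 complex) \<Rightarrow> ('k \<Rightarrow>\<^sub>0 complex)" where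
  "pscale c f = Poly_Mapping.map (\<lambda>x. c * x) f"

definition lin_ext :: "('k \<Rightarrow> ('l \<Rightarrow>\<^sub>0 complex)) \<Rightarrow> ('k \<Rightarrow>\<^sub>0 complex) \<Rightarrow> ('l \<Rightarrow>\<^sub>0 complex)" where
  "lin_ext f X = (\<Sum>w\<in>Poly_Mapping.keys X. pscale (Poly_Mapping.lookup X w) (f w))"

definition gen_word :: "'i gen list \<Rightarrow> 'i free_alg" where
  "gen_word gs = Poly_Mapping.single (Word gs) 1"

abbreviation gK :: "'i \<Rightarrow> 'i free_alg" where "gK i \<equiv> gen_word [GenK i]"
abbreviation gKinv :: "'i \<Rightarrow> 'i free_alg" where "gKinv i \<equiv> gen_word [GenKinv i]"
abbreviation gE :: "'i \<Rightarrow> 'i free_alg" where "gE i \<equiv> gen_word [GenE i]"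
abbreviation gF :: "'i \<Rightarrow> 'i free_alg" where "gF i \<equiv> gen_word [GenF i]"

definition tens2 :: "'i free_alg \<Rightarrow> 'i free_alg \<Rightarrow> 'i free_alg2" where
  "tens2 X Y = (\<Sum>v\<in>Poly_Mapping.keys X. \<Sum>w\<in>Poly_Mapping.keys Y.
     Poly_Mapping.single (v, w) (Poly_Mapping.lookup X v * Poly_Mapping.lookup Y w))"

section \<open>The quantized enveloping algebra\<close>

definition qint :: "real \<Rightarrow> nat \<Rightarrow> real" where
  "qint x n = (x ^ n - inverse x ^ n) / (x - inverse x)"

definition qfact :: "real \<Rightarrow> nat \<Rightarrow> real" where
  "qfact x n = (\<Prod>k=1..n. qint x k)"

definition qbinom :: "real \<Rightarrow> nat \<Rightarrow> nat \<Rightarrow> real" where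
  "qbinom x n k = qfact x n / (qfact x k * qfact x (n - k))"

definition qi :: "real \<Rightarrow> ('i::finite \<Rightarrow> 'a::euclidean_space) \<Rightarrow> 'i \<Rightarrow> real" where
  "qi q \<alpha> i = q powr (inner (\<alpha> i) (\<alpha> i) / 2)"

definition serre :: "real \<Rightarrow> ('i::finite \<Rightarrow> 'a::euclidean_space) \<Rightarrow> ('i \<Rightarrow> 'i free_alg) \<Rightarrow>
    'i \<Rightarrow> 'i \<Rightarrow> 'i free_alg" where
  "serre q \<alpha> X i j = (let m = nat (1 - cartan_entry \<alpha> i j) in
     \<Sum>s=0..m. pscale (complex_of_real ((-1) ^ s * qbinom (qi q \<alpha> i) m s))
       (X i ^ (m - s) * X j * X i ^ s))"

definition Uq_relations :: "real \<Rightarrow> ('i::finite \<Rightarrow> 'a::euclidean_space) \<Rightarrow> 'i free_alg set" where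
  "Uq_relations q \<alpha> =
     {gK i * gKinv i - 1 | i. True} \<union> {gKinv i * gK i - 1 | i. True} \<union>
     {gK i * gK j - gK j * gK i | i j. True} \<union>
     {gK i * gE j * gKinv i - pscale (complex_of_real (q powr inner (\<alpha> i) (\<alpha> j))) (gE j) | i j. True} \<union>
     {gK i * gF j * gKinv i - pscale (complex_of_real (q powr (- inner (\<alpha> i) (\<alpha> j)))) (gF j) | i j. True} \<union>
     {gE i * gF j - gF j * gE i -
        (if i = j then pscale (complex_of_real (1 / (qi q \<alpha> i - inverse (qi q \<alpha> i)))) (gK i - gKinv i)
         else 0) | i j. True} \<union>
     {serre q \<alpha> gE i j | i j. i \<noteq> j} \<union> {serre q \<alpha> gF i j | i j. i \<noteq> j}"

text \<open>
  The algebra \<open>U\<^sub>q(\<gg>)\<close> is the quotient of the free algebra by this two-sided ideal. Elements of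
  \<open>U\<^sub>q(\<gg>)\<close> are represented by elements of the free algebra; its modules and its linear functionals
  are those of the free algebra that vanish on the ideal.
\<close>

definition Uq_ideal :: "real \<Rightarrow> ('i::finite \<Rightarrow> 'a::euclidean_space) \<Rightarrow> 'i free_alg set" where
  "Uq_ideal q \<alpha> = module.span pscale {X * r * Y | X r Y. r \<in> Uq_relations q \<alpha>}"

text \<open>
  The structure maps preserve the ideal and are given by representatives on the free algebra:
  \<open>coprod\<close> and \<open>counit\<close> are the algebra homomorphisms, \<open>antip\<close> the linear and \<open>star\<close> the
  conjugate-linear anti-homomorphism with the stated values on the generators.
\<close>

fun coprod_gen :: "'i gen \<Rightarrow> 'i free_alg2" where
  "coprod_gen (GenK i) = tens2 (gK i) (gK i)"
| "coprod_gen (GenKinv i) = tens2 (gKinv i) (gKinv i)"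
| "coprod_gen (GenE i) = tens2 (gE i) (gK i) + tens2 1 (gE i)"
| "coprod_gen (GenF i) = tens2 (gF i) 1 + tens2 (gKinv i) (gF i)"

definition coprod :: "'i free_alg \<Rightarrow> 'i free_alg2" where
  "coprod = lin_ext (\<lambda>w. prod_list (map coprod_gen (letters w)))"

fun counit_gen :: "'i gen \<Rightarrow> complex" where
  "counit_gen (GenK i) = 1"
| "counit_gen (GenKinv i) = 1"
| "counit_gen (GenE i) = 0"
| "counit_gen (GenF i) = 0"

definition counit :: "'i free_alg \<Rightarrow> complex" where
  "counit X = (\<Sum>w\<in>Poly_Mapping.keys X.
     Poly_Mapping.lookup X w * prod_list (map counit_gen (letters w)))"

fun antip_gen :: "'i gen \<Rightarrow> 'i free_alg" where
  "antip_gen (GenK i) = gKinv i"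
| "antip_gen (GenKinv i) = gK i"
| "antip_gen (GenE i) = - (gE i * gKinv i)"
| "antip_gen (GenF i) = - (gK i * gF i)"

definition antip :: "'i free_alg \<Rightarrow> 'i free_alg" where
  "antip = lin_ext (\<lambda>w. prod_list (map antip_gen (rev (letters w))))"

fun star_gen :: "'i gen \<Rightarrow> 'i free_alg" where
  "star_gen (GenK i) = gK i"
| "star_gen (GenKinv i) = gKinv i"
| "star_gen (GenE i) = gK i * gF i"
| "star_gen (GenF i) = gE i * gKinv i"

definition star :: "'i free_alg \<Rightarrow> 'i free_alg" where
  "star X = (\<Sum>w\<in>Poly_Mapping.keys X.
     pscale (cnj (Poly_Mapping.lookup X w)) (prod_list (map star_gen (rev (letters w)))))"

inductive_set Uq_levi :: "'i set \<Rightarrow> 'i free_alg set" for S :: "'i set" where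
  "1 \<in> Uq_levi S"
| "gK i \<in> Uq_levi S"
| "gKinv i \<in> Uq_levi S"
| "j \<in> S \<Longrightarrow> gE j \<in> Uq_levi S"
| "j \<in> S \<Longrightarrow> gF j \<in> Uq_levi S"
| "X \<in> Uq_levi S \<Longrightarrow> Y \<in> Uq_levi S \<Longrightarrow> X + Y \<in> Uq_levi S"
| "X \<in> Uq_levi S \<Longrightarrow> Y \<in> Uq_levi S \<Longrightarrow> X * Y \<in> Uq_levi S"
| "X \<in> Uq_levi S \<Longrightarrow> pscale c X \<in> Uq_levi S"

text \<open>
  The element \<open>K\<^sub>w\<close> for \<open>w\<close> in the root lattice. The order on \<open>'i\<close> only serves to write the product
  of the commuting factors as a word.
\<close>

definition root_coords :: "('i::finite \<Rightarrow> 'a::euclidean_space) \<Rightarrow> 'a \<Rightarrow> 'i \<Rightarrow> int" where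
  "root_coords \<alpha> w = (THE n. w = (\<Sum>i\<in>UNIV. real_of_int (n i) *\<^sub>R \<alpha> i))"

definition Kel :: "('i::{finite,linorder} \<Rightarrow> 'a::euclidean_space) \<Rightarrow> 'a \<Rightarrow> 'i free_alg" where
  "Kel \<alpha> w = prod_list (map (\<lambda>i. let n = root_coords \<alpha> w i in
       if n \<ge> 0 then gK i ^ nat n else gKinv i ^ nat (- n)) (sorted_list_of_set UNIV))"

section \<open>Representations\<close>

definition Uq_rep :: "real \<Rightarrow> ('i::finite \<Rightarrow> 'a::euclidean_space) \<Rightarrow> nat \<Rightarrow>
    ('i free_alg \<Rightarrow> complex mat) \<Rightarrow> bool" where
  "Uq_rep q \<alpha> n \<pi> \<longleftrightarrow>
     (\<forall>X. \<pi> X \<in> carrier_mat n n) \<and> \<pi> 1 = 1\<^sub>m n \<and>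
     (\<forall>X Y. \<pi> (X * Y) = \<pi> X * \<pi> Y) \<and> (\<forall>X Y. \<pi> (X + Y) = \<pi> X + \<pi> Y) \<and>
     (\<forall>c X. \<pi> (pscale c X) = c \<cdot>\<^sub>m \<pi> X) \<and>
     (\<forall>X\<in>Uq_ideal q \<alpha>. \<pi> X = 0\<^sub>m n n)"

definition irreducible_rep :: "nat \<Rightarrow> ('i free_alg \<Rightarrow> complex mat) \<Rightarrow> bool" where
  "irreducible_rep n \<pi> \<longleftrightarrow> n > 0 \<and>
     (\<forall>W \<subseteq> carrier_vec n.
        0\<^sub>v n \<in> W \<and> (\<forall>v\<in>W. \<forall>w\<in>W. v + w \<in> W) \<and> (\<forall>c. \<forall>v\<in>W. c \<cdot>\<^sub>v v \<in> W) \<and>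
        (\<forall>X. \<forall>v\<in>W. \<pi> X *\<^sub>v v \<in> W) \<longrightarrow> W = {0\<^sub>v n} \<or> W = carrier_vec n)"

definition weight_vector :: "real \<Rightarrow> ('i::finite \<Rightarrow> 'a::euclidean_space) \<Rightarrow> nat \<Rightarrow>
    ('i free_alg \<Rightarrow> complex mat) \<Rightarrow> 'a \<Rightarrow> complex vec \<Rightarrow> bool" where
  "weight_vector q \<alpha> n \<pi> \<mu> v \<longleftrightarrow> v \<in> carrier_vec n \<and> v \<noteq> 0\<^sub>v n \<and>
     (\<forall>i. \<pi> (gK i) *\<^sub>v v = complex_of_real (q powr inner \<mu> (\<alpha> i)) \<cdot>\<^sub>v v)"

definition highest_weight_vector :: "real \<Rightarrow> ('i::finite \<Rightarrow> 'a::euclidean_space) \<Rightarrow> nat \<Rightarrow>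
    ('i free_alg \<Rightarrow> complex mat) \<Rightarrow> 'a \<Rightarrow> complex vec \<Rightarrow> bool" where
  "highest_weight_vector q \<alpha> n \<pi> \<mu> v \<longleftrightarrow>
     weight_vector q \<alpha> n \<pi> \<mu> v \<and> (\<forall>i. \<pi> (gE i) *\<^sub>v v = 0\<^sub>v n)"

text \<open>The matrices \<open>\<pi>\<close> realize the irreducible highest weight module \<open>V(\<mu>)\<close> on \<open>\<complex>\<^sup>n\<close>.\<close>

definition is_V :: "real \<Rightarrow> ('i::finite \<Rightarrow> 'a::euclidean_space) \<Rightarrow> 'a \<Rightarrow> nat \<Rightarrow>
    ('i free_alg \<Rightarrow> complex mat) \<Rightarrow> bool" where
  "is_V q \<alpha> \<mu> n \<pi> \<longleftrightarrow> Uq_rep q \<alpha> n \<pi> \<and> irreducible_rep n \<pi> \<and>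
     (\<exists>v. highest_weight_vector q \<alpha> n \<pi> \<mu> v)"

definition inner_product_on :: "nat \<Rightarrow> (complex vec \<Rightarrow> complex vec \<Rightarrow> complex) \<Rightarrow> bool" where
  "inner_product_on n B \<longleftrightarrow>
     (\<forall>u\<in>carrier_vec n. \<forall>v\<in>carrier_vec n. \<forall>w\<in>carrier_vec n. B u (v + w) = B u v + B u w) \<and>
     (\<forall>u\<in>carrier_vec n. \<forall>v\<in>carrier_vec n. \<forall>c. B u (c \<cdot>\<^sub>v v) = c * B u v) \<and>
     (\<forall>u\<in>carrier_vec n. \<forall>v\<in>carrier_vec n. B v u = cnj (B u v)) \<and>
     (\<forall>v\<in>carrier_vec n. v \<noteq> 0\<^sub>v n \<longrightarrow> Re (B v v) > 0)"

definition invariant_inner_product :: "nat \<Rightarrow> ('i free_alg \<Rightarrow> complex mat) \<Rightarrow>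
    (complex vec \<Rightarrow> complex vec \<Rightarrow> complex) \<Rightarrow> bool" where
  "invariant_inner_product n \<pi> B \<longleftrightarrow> inner_product_on n B \<and>
     (\<forall>X. \<forall>v\<in>carrier_vec n. \<forall>w\<in>carrier_vec n. B (\<pi> X *\<^sub>v v) w = B v (\<pi> (star X) *\<^sub>v w))"

section \<open>The quantized coordinate ring and the quantum flag manifold\<close>

type_synonym 'i functional = "'i free_alg \<Rightarrow> complex"

text \<open>The linear functional \<open>a \<otimes> b\<close> on the tensor square of the free algebra.\<close>

definition tens_fun :: "'i functional \<Rightarrow> 'i functional \<Rightarrow> 'i free_alg2 \<Rightarrow> complex" where
  "tens_fun a b Z = (\<Sum>(v, w)\<in>Poly_Mapping.keys Z. Poly_Mapping.lookup Z (v, w) *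
     a (Poly_Mapping.single v 1) * b (Poly_Mapping.single w 1))"

definition fmult :: "'i functional \<Rightarrow> 'i functional \<Rightarrow> 'i functional" where
  "fmult a b = (\<lambda>X. tens_fun a b (coprod X))"

definition fstar :: "'i functional \<Rightarrow> 'i functional" where
  "fstar a = (\<lambda>X. cnj (a (star (antip X))))"

definition lact :: "'i free_alg \<Rightarrow> 'i functional \<Rightarrow> 'i functional" where
  "lact X a = (\<lambda>Y. a (Y * X))"

definition ract :: "'i functional \<Rightarrow> 'i free_alg \<Rightarrow> 'i functional" where
  "ract a X = (\<lambda>Y. a (X * Y))"

text \<open>
  The span of the matrix coefficients \<open>X \<mapsto> f (X v)\<close>; a linear functional \<open>f\<close> on \<open>\<complex>\<^sup>n\<close> is given by a
  (row) vector, with \<open>scalar_prod\<close> the bilinear pairing.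
\<close>

inductive_set Cq_U :: "real \<Rightarrow> ('i::finite \<Rightarrow> 'a::euclidean_space) \<Rightarrow> 'i functional set"
  for q :: real and \<alpha> :: "'i \<Rightarrow> 'a" where
  coeff: "dominant_weight \<alpha> \<mu> \<Longrightarrow> is_V q \<alpha> \<mu> n \<pi> \<Longrightarrow> f \<in> carrier_vec n \<Longrightarrow> v \<in> carrier_vec n \<Longrightarrow>
     (\<lambda>X. scalar_prod f (\<pi> X *\<^sub>v v)) \<in> Cq_U q \<alpha>"
| add: "a \<in> Cq_U q \<alpha> \<Longrightarrow> b \<in> Cq_U q \<alpha> \<Longrightarrow> (\<lambda>X. a X + b X) \<in> Cq_U q \<alpha>"
| scale: "a \<in> Cq_U q \<alpha> \<Longrightarrow> (\<lambda>X. c * a X) \<in> Cq_U q \<alpha>"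

definition Cq_flag :: "real \<Rightarrow> ('i::finite \<Rightarrow> 'a::euclidean_space) \<Rightarrow> 'i set \<Rightarrow>
    (complex, 'i functional) module" where
  "Cq_flag q \<alpha> S =
     \<lparr>carrier = {a \<in> Cq_U q \<alpha>. \<forall>X\<in>Uq_levi S. lact X a = (\<lambda>Y. counit X * a Y)},
      monoid.mult = fmult, one = counit, zero = (\<lambda>X. 0), add = (\<lambda>a b X. a X + b X),
      smult = (\<lambda>c a X. c * a X)\<rparr>"

text \<open>
  The modular automorphism of the Haar state, given by its formula
  \<open>a \<mapsto> K\<^bsub>2\<rho>\<^esub> \<triangleright> a \<triangleleft> K\<^bsub>2\<rho>\<^esub>\<close>; the two actions commute.
\<close>

definition modular_aut :: "'a::euclidean_space set \<Rightarrow> ('i::{finite,linorder} \<Rightarrow> 'a) \<Rightarrow>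
    'i functional \<Rightarrow> 'i functional" where
  "modular_aut \<Phi> \<alpha> a =
     (let K = Kel \<alpha> (2 *\<^sub>R rho \<Phi> \<alpha>) in lact K (ract a K))"

section \<open>Twisted Hochschild homology\<close>

text \<open>
  A formal combination of lists \<open>[m, a\<^sub>1, \<dots>, a\<^sub>n]\<close> of elements of the algebra represents a normalized
  Hochschild chain of degree \<open>n\<close>, the list standing for \<open>m \<otimes> a\<^sub>1 \<otimes> \<dots> \<otimes> a\<^sub>n\<close>. The chains that
  represent \<open>0\<close> are spanned by the relations of multilinearity and the lists with \<open>a\<^sub>k = 1\<close> for
  some \<open>k \<ge> 1\<close>, so that the quotient is \<open>A \<otimes> (A / \<complex>1)\<^sup>\<otimes>\<^sup>n\<close>.
\<close>

type_synonym 'a hchain = "'a list \<Rightarrow>\<^sub>0 complex"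

definition hlists :: "(complex, 'a) module \<Rightarrow> nat \<Rightarrow> 'a list set" where
  "hlists A n = {xs. length xs = Suc n \<and> set xs \<subseteq> carrier A}"

definition hchains :: "(complex, 'a) module \<Rightarrow> nat \<Rightarrow> 'a hchain set" where
  "hchains A n = {c. Poly_Mapping.keys c \<subseteq> hlists A n}"

definition tensor_relations :: "(complex, 'a) module \<Rightarrow> nat \<Rightarrow> 'a hchain set" where
  "tensor_relations A n =
     {Poly_Mapping.single (xs @ (x \<oplus>\<^bsub>A\<^esub> y) # ys) 1
        - Poly_Mapping.single (xs @ x # ys) 1 - Poly_Mapping.single (xs @ y # ys) 1 | xs x y ys.
        xs @ x # ys \<in> hlists A n \<and> y \<in> carrier A} \<union>
     {Poly_Mapping.single (xs @ (c \<odot>\<^bsub>A\<^esub> x) # ys) 1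
        - Poly_Mapping.single (xs @ x # ys) c | xs c x ys.
        xs @ x # ys \<in> hlists A n} \<union>
     {Poly_Mapping.single (m # xs @ \<one>\<^bsub>A\<^esub> # ys) 1 | m xs ys. m # xs @ \<one>\<^bsub>A\<^esub> # ys \<in> hlists A n}"

definition null_chains :: "(complex, 'a) module \<Rightarrow> nat \<Rightarrow> 'a hchain set" where
  "null_chains A n = module.span pscale (tensor_relations A n)"

definition face :: "(complex, 'a) module \<Rightarrow> nat \<Rightarrow> 'a list \<Rightarrow> 'a list" where
  "face A i xs = take i xs @ ((xs ! i) \<otimes>\<^bsub>A\<^esub> (xs ! Suc i)) # drop (i + 2) xs"

definition last_face :: "(complex, 'a) module \<Rightarrow> ('a \<Rightarrow> 'a) \<Rightarrow> 'a list \<Rightarrow> 'a list" where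
  "last_face A \<sigma> xs = (\<sigma> (last xs) \<otimes>\<^bsub>A\<^esub> hd xs) # butlast (tl xs)"

definition hboundary :: "(complex, 'a) module \<Rightarrow> ('a \<Rightarrow> 'a) \<Rightarrow> nat \<Rightarrow> 'a hchain \<Rightarrow> 'a hchain" where
  "hboundary A \<sigma> n = (if n = 0 then (\<lambda>c. 0) else
     lin_ext (\<lambda>xs. (\<Sum>i<n. Poly_Mapping.single (face A i xs) ((-1) ^ i))
                     + Poly_Mapping.single (last_face A \<sigma> xs) ((-1) ^ n)))"

definition hcycles :: "(complex, 'a) module \<Rightarrow> ('a \<Rightarrow> 'a) \<Rightarrow> nat \<Rightarrow> 'a hchain set" where
  "hcycles A \<sigma> n = {c \<in> hchains A n. hboundary A \<sigma> n c \<in> null_chains A (n - 1)}"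

definition hboundaries :: "(complex, 'a) module \<Rightarrow> ('a \<Rightarrow> 'a) \<Rightarrow> nat \<Rightarrow> 'a hchain set" where
  "hboundaries A \<sigma> n =
     {hboundary A \<sigma> (Suc n) c + r | c r. c \<in> hchains A (Suc n) \<and> r \<in> null_chains A n}"

definition cycle_group :: "(complex, 'a) module \<Rightarrow> ('a \<Rightarrow> 'a) \<Rightarrow> nat \<Rightarrow> 'a hchain monoid" where
  "cycle_group A \<sigma> n = \<lparr>carrier = hcycles A \<sigma> n, monoid.mult = (+), one = 0\<rparr>"

definition HH :: "(complex, 'a) module \<Rightarrow> ('a \<Rightarrow> 'a) \<Rightarrow> nat \<Rightarrow> 'a hchain set monoid" where
  "HH A \<sigma> n = cycle_group A \<sigma> n Mod hboundaries A \<sigma> n"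

definition HH_class :: "(complex, 'a) module \<Rightarrow> ('a \<Rightarrow> 'a) \<Rightarrow> nat \<Rightarrow> 'a hchain \<Rightarrow> 'a hchain set" where
  "HH_class A \<sigma> n c = hboundaries A \<sigma> n #>\<^bsub>cycle_group A \<sigma> n\<^esub> c"

section \<open>The chain \<open>C(P\<^sub>1)\<close>\<close>

text \<open>Basis vectors are numbered from \<open>0\<close>, so the highest weight vector is \<open>v 0\<close>.\<close>

definition mcoeff :: "('i free_alg \<Rightarrow> complex mat) \<Rightarrow> (complex vec \<Rightarrow> complex vec \<Rightarrow> complex) \<Rightarrow>
    (nat \<Rightarrow> complex vec) \<Rightarrow> nat \<Rightarrow> nat \<Rightarrow> 'i functional" where
  "mcoeff \<pi> B v i j = (\<lambda>X. B (v i) (\<pi> X *\<^sub>v v j))"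

definition proj_entry :: "('i free_alg \<Rightarrow> complex mat) \<Rightarrow> (complex vec \<Rightarrow> complex vec \<Rightarrow> complex) \<Rightarrow>
    (nat \<Rightarrow> complex vec) \<Rightarrow> nat \<Rightarrow> nat \<Rightarrow> 'i functional" where
  "proj_entry \<pi> B v i j = fmult (mcoeff \<pi> B v i 0) (fstar (mcoeff \<pi> B v j 0))"

definition chain_C :: "real \<Rightarrow> 'a::euclidean_space set \<Rightarrow> ('i::finite \<Rightarrow> 'a) \<Rightarrow> nat \<Rightarrow>
    (nat \<Rightarrow> 'a) \<Rightarrow> (nat \<Rightarrow> nat \<Rightarrow> 'i functional) \<Rightarrow> 'i functional hchain" where
  "chain_C q \<Phi> \<alpha> N wt p = (\<Sum>i<N. \<Sum>j<N. \<Sum>k<N.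
     Poly_Mapping.single
       [(\<lambda>X. 2 * p i j X - (if i = j then 1 else 0) * counit X), p j k, p k i]
       (complex_of_real (q powr inner (2 *\<^sub>R rho \<Phi> \<alpha>) (wt i))))"

end

theory Submission
  imports Defs "HOL-Analysis.Linear_Algebra" "Jordan_Normal_Form.Determinant"
begin

text \<open>
  On the quantum flag manifold every functional satisfies \<open>a(K) = a(1)\<close> for \<open>K\<close> in the torus.
  Hence \<open>\<epsilon>\<close> is invariant under \<open>\<theta>\<close>, and evaluation at \<open>E\<^sub>r\<close> and at \<open>F\<^sub>r\<close> are \<open>\<epsilon>\<close>-derivations,
  so \<open>\<phi>(a, b, c) = a(1) b(E\<^sub>r) c(F\<^sub>r)\<close> is a normalized \<open>\<theta>\<close>-twisted Hochschild 2-cocycle. As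
  \<open>v\<^sub>1\<close> is a highest weight vector, only the terms with \<open>i = j = 1\<close> of \<open>C(P\<^sub>1)\<close> contribute, and \<open>\<phi>\<close>
  takes on it the value \<open>- q\<^bsup>(2\<rho>,\<lambda>\<^sub>1)\<^esup> \<parallel>F\<^sub>r v\<^sub>1\<parallel>\<^sup>2\<close>. For \<open>r \<notin> S\<close> this is nonzero, because \<open>E\<^sub>r F\<^sub>r v\<^sub>1\<close> is
  then a nonzero multiple of \<open>v\<^sub>1\<close>.
\<close>

section \<open>Linear forms on finitely supported functions\<close>

text \<open>Serves two purposes: when the keys are lists it evaluates a cochain on a chain, and when
  they are pairs of words it evaluates a tensor product of functionals on the tensor square of the
  free algebra.\<close>

definition pairing :: "('k \<Rightarrow> complex) \<Rightarrow> ('k \<Rightarrow>\<^sub>0 complex) \<Rightarrow> complex" where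
  "pairing \<phi> c = (\<Sum>k\<in>Poly_Mapping.keys c. Poly_Mapping.lookup c k * \<phi> k)"

text \<open>Supports may shrink under sums and scalings; summing over a common finite superset makes
  both operations termwise.\<close>

lemma pairing_superset:
  assumes "finite A" "Poly_Mapping.keys c \<subseteq> A"
  shows "pairing \<phi> c = (\<Sum>k\<in>A. Poly_Mapping.lookup c k * \<phi> k)"
  unfolding pairing_def using assms
  by (intro sum.mono_neutral_left) (auto simp: in_keys_iff)

lemma lookup_pscale [simp]: "Poly_Mapping.lookup (pscale c f) k = c * Poly_Mapping.lookup f k"
  unfolding pscale_def by (simp add: Poly_Mapping.map.rep_eq when_def)

lemma pairing_zero [simp]: "pairing \<phi> 0 = 0"
  by (simp add: pairing_def)

lemma pairing_single [simp]: "pairing \<phi> (Poly_Mapping.single k c) = c * \<phi> k"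
  by (simp add: pairing_def)

lemma pairing_add: "pairing \<phi> (c + d) = pairing \<phi> c + pairing \<phi> d"
  using Poly_Mapping.keys_add[of c d]
  by (simp add: pairing_superset[where A = "Poly_Mapping.keys c \<union> Poly_Mapping.keys d"]
      lookup_add ring_distribs sum.distrib)

lemma pairing_pscale: "pairing \<phi> (pscale a c) = a * pairing \<phi> c"
proof -
  have "Poly_Mapping.keys (pscale a c) \<subseteq> Poly_Mapping.keys c"
    by (auto simp: in_keys_iff)
  then show ?thesis
    by (simp add: pairing_superset[where A = "Poly_Mapping.keys c"] sum_distrib_left mult.assoc)
qed

lemma pairing_uminus: "pairing \<phi> (- c) = - pairing \<phi> c"
  using pairing_add[of \<phi> c "- c"] by (simp add: eq_neg_iff_add_eq_0 add.commute)

lemma pairing_diff: "pairing \<phi> (c - d) = pairing \<phi> c - pairing \<phi> d"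
  using pairing_add[of \<phi> c "- d"] by (simp add: pairing_uminus)

lemma pairing_sum: "pairing \<phi> (\<Sum>x\<in>A. f x) = (\<Sum>x\<in>A. pairing \<phi> (f x))"
  by (induction A rule: infinite_finite_induct) (auto simp: pairing_add)

lemma pairing_lin_ext: "pairing \<phi> (lin_ext f c) = pairing (\<lambda>k. pairing \<phi> (f k)) c"
  by (simp add: lin_ext_def pairing_sum pairing_pscale pairing_def[of _ c])

lemma module_pscale: "Modules.module pscale"
  by standard (auto intro!: poly_mapping_eqI simp: lookup_add algebra_simps)

lemma pscale_one [simp]: "pscale 1 f = f"
  by (rule poly_mapping_eqI) simp

lemma pscale_uminus: "pscale (- c) f = - pscale c f"
  by (rule poly_mapping_eqI) simp

lemma lin_ext_single [simp]: "lin_ext f (Poly_Mapping.single w c) = pscale c (f w)"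
  by (auto simp: lin_ext_def intro!: poly_mapping_eqI)

section \<open>The Hopf structure evaluated on generators\<close>

lemma one_eq_gen_word: "(1 :: 'i free_alg) = gen_word []"
  by (simp add: gen_word_def zero_word_def flip: single_one)

lemma gen_word_mult [simp]: "gen_word gs * gen_word hs = gen_word (gs @ hs)"
  by (simp add: gen_word_def mult_single plus_word_def)

lemma fmult_eq_pairing:
  "fmult a b X = pairing (\<lambda>(v, w). a (Poly_Mapping.single v 1) * b (Poly_Mapping.single w 1)) (coprod X)"
  by (auto simp: fmult_def tens_fun_def pairing_def mult.assoc intro!: sum.cong)

lemma coprod_gen_word: "coprod (gen_word gs) = prod_list (map coprod_gen gs)"
  by (simp add: coprod_def gen_word_def)

lemma pairing_tens2_gen_word:
  "pairing (\<lambda>(v, w). a (Poly_Mapping.single v 1) * b (Poly_Mapping.single w 1))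
     (tens2 (gen_word gs) (gen_word hs)) = a (gen_word gs) * b (gen_word hs)"
  by (simp add: tens2_def gen_word_def)

lemma fmult_one: "fmult a b 1 = a 1 * b 1"
proof -
  have "fmult a b 1 = pairing (\<lambda>(v, w). a (Poly_Mapping.single v 1) * b (Poly_Mapping.single w 1))
      (Poly_Mapping.single 0 1)"
    by (simp add: fmult_eq_pairing one_eq_gen_word coprod_gen_word)
  then show ?thesis
    by (simp add: zero_prod_def)
qed

text \<open>Read off from the coproduct of \<open>gE r\<close>. As soon as
  \<open>b (gK r) = b 1\<close>, this is the Leibniz rule of a derivation relative to the counit;
  \<open>fmult_gF\<close> plays the same role for \<open>gF r\<close>.\<close>

lemma fmult_gE: "fmult a b (gE r) = a (gE r) * b (gK r) + a 1 * b (gE r)"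
  by (simp add: fmult_eq_pairing coprod_gen_word pairing_add pairing_tens2_gen_word one_eq_gen_word)

lemma fmult_gF: "fmult a b (gF r) = a (gF r) * b 1 + a (gKinv r) * b (gF r)"
  by (simp add: fmult_eq_pairing coprod_gen_word pairing_add pairing_tens2_gen_word one_eq_gen_word)

lemma counit_gen_word: "counit (gen_word gs) = prod_list (map counit_gen gs)"
  by (simp add: counit_def gen_word_def)

lemma counit_one: "counit 1 = 1"
  by (simp add: one_eq_gen_word counit_gen_word)

lemma antip_gen_word: "antip (gen_word gs) = prod_list (map antip_gen (rev gs))"
  by (simp add: antip_def gen_word_def)

lemma star_gen_word: "star (gen_word gs) = prod_list (map star_gen (rev gs))"
  by (simp add: star_def gen_word_def)

lemma star_uminus: "star (- X) = - star X"
  by (simp add: star_def keys_minus pscale_uminus sum_negf)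

lemma star_antip_one: "star (antip (1 :: 'i free_alg)) = 1"
  using antip_gen_word[of "[] :: 'i gen list"] star_gen_word[of "[] :: 'i gen list"]
  by (simp flip: one_eq_gen_word)

text \<open>An identity in the free algebra, so the adjacent \<open>GenKinv r\<close> and
  \<open>GenK r\<close> stay in the word; they cancel only after a representation is applied,
  leaving minus the action of \<open>gF r\<close>.\<close>

lemma star_antip_gE: "star (antip (gE r)) = - (gen_word [GenKinv r, GenK r, GenF r])"
  by (simp add: antip_gen_word star_gen_word star_uminus)

lemma star_antip_gF: "star (antip (gF r)) = - (gen_word [GenE r, GenKinv r, GenK r])"
  by (simp add: antip_gen_word star_gen_word star_uminus)

section \<open>Torus invariance of functions on the flag manifold\<close>

fun torus_gen :: "'i gen \<Rightarrow> bool" where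
  "torus_gen (GenK i) = True"
| "torus_gen (GenKinv i) = True"
| "torus_gen _ = False"

lemma gen_word_torus_in_levi: "list_all torus_gen gs \<Longrightarrow> gen_word gs \<in> Uq_levi S"
proof (induction gs)
  case Nil
  then show ?case using Uq_levi.intros(1)[of S] by (simp add: one_eq_gen_word)
next
  case (Cons g gs)
  have "gen_word (g # gs) = gen_word [g] * gen_word gs"
    by simp
  moreover have "gen_word [g] \<in> Uq_levi S"
    using Cons.prems by (cases g) (auto intro: Uq_levi.intros)
  ultimately show ?case
    using Cons Uq_levi.intros(7)[of "gen_word [g]" S "gen_word gs"] by simp
qed

lemma counit_gen_word_torus: "list_all torus_gen gs \<Longrightarrow> counit (gen_word gs) = 1"
proof (induction gs)
  case (Cons g gs)
  then show ?case by (cases g) (auto simp: counit_gen_word)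
qed (simp add: counit_gen_word)

lemma gen_word_power: "\<exists>hs. gen_word [g] ^ n = gen_word hs \<and> set hs \<subseteq> {g}"
proof (induction n)
  case 0
  then show ?case by (intro exI[of _ "[]"]) (simp add: one_eq_gen_word)
next
  case (Suc n)
  then obtain hs where "gen_word [g] ^ n = gen_word hs" "set hs \<subseteq> {g}" by blast
  then show ?case by (intro exI[of _ "g # hs"]) simp
qed

lemma Kel_torus: "\<exists>gs. Kel \<alpha> w = gen_word gs \<and> list_all torus_gen gs"
proof -
  \<comment> \<open>The exponents \<open>f\<close> are arbitrary integers: any product of powers of
    the \<open>gK i\<close> and \<open>gKinv i\<close> is a single word in torus generators.\<close>
  have "\<exists>gs. prod_list (map (\<lambda>i. let n = f i in
       if n \<ge> 0 then gK i ^ nat n else gKinv i ^ nat (- n)) xs) = gen_word gs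
       \<and> list_all torus_gen gs" for f :: "'i \<Rightarrow> int" and xs
  proof (induction xs)
    case Nil
    then show ?case by (intro exI[of _ "[]"]) (simp add: one_eq_gen_word)
  next
    case (Cons x xs)
    then obtain gs where gs: "prod_list (map (\<lambda>i. let n = f i in
       if n \<ge> 0 then gK i ^ nat n else gKinv i ^ nat (- n)) xs) = gen_word gs"
      "list_all torus_gen gs" by blast
    obtain hs where "(let n = f x in
       if n \<ge> 0 then gK x ^ nat n else gKinv x ^ nat (- n)) = gen_word hs"
      "set hs \<subseteq> {GenK x, GenKinv x}"
      using gen_word_power[of "GenK x" "nat (f x)"] gen_word_power[of "GenKinv x" "nat (- f x)"]
      by (cases "f x \<ge> 0") (fastforce simp: Let_def)+
    then show ?case using gs
      by (intro exI[of _ "hs @ gs"]) (auto simp: list_all_iff)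
  qed
  then show ?thesis unfolding Kel_def by blast
qed

text \<open>The Levi subalgebra contains all torus words, whatever \<open>S\<close> is, and the
  counit is 1 on them; evaluating the invariance condition at 1 gives the claim.\<close>

lemma flag_apply_torus:
  assumes "a \<in> carrier (Cq_flag q \<alpha> S)" "list_all torus_gen gs"
  shows "a (gen_word gs) = a 1"
proof -
  have "lact (gen_word gs) a = (\<lambda>Y. counit (gen_word gs) * a Y)"
    using assms gen_word_torus_in_levi[of gs S] by (auto simp: Cq_flag_def)
  then have "lact (gen_word gs) a 1 = a 1"
    using assms(2) by (simp add: counit_gen_word_torus)
  then show ?thesis by (simp add: lact_def)
qed

text \<open>At 1 the two actions of K =
  \<open>Kel \<alpha> (2 *\<^sub>R rho \<Phi> \<alpha>)\<close> combine to \<open>a\<close>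
  evaluated at K K, which is again a torus word.\<close>

lemma modular_aut_one:
  assumes "a \<in> carrier (Cq_flag q \<alpha> S)"
  shows "modular_aut \<Phi> \<alpha> a 1 = a 1"
proof -
  obtain gs where gs: "Kel \<alpha> (2 *\<^sub>R rho \<Phi> \<alpha>) = gen_word gs" "list_all torus_gen gs"
    using Kel_torus by blast
  then show ?thesis
    using flag_apply_torus[OF assms, of "gs @ gs"]
    by (simp add: modular_aut_def Let_def lact_def ract_def)
qed

section \<open>A twisted 2-cocycle detecting homology classes\<close>

text \<open>The cup product of the counit (evaluation at 1) with the two derivations given by
  \<open>gE r\<close> and \<open>gF r\<close>. For \<open>r\<close> in \<open>S\<close> it would
  vanish on the flag manifold, so \<open>r\<close> is later taken outside \<open>S\<close>.\<close>

definition cocycle :: "'i \<Rightarrow> 'i functional list \<Rightarrow> complex" where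
  "cocycle r xs = (xs ! 0) 1 * (xs ! 1) (gE r) * (xs ! 2) (gF r)"

text \<open>Expanding the products of [a, b, c, d] by the Leibniz rules, the inner faces telescope
  to a(1) b(E) c(F) d(1). The last face has the same value because the twist preserves evaluation at
  1; in the boundary it carries the sign -1.\<close>

lemma cocycle_face_sum:
  assumes xs: "xs \<in> hlists (Cq_flag q \<alpha> S) 3"
  shows "(\<Sum>i<3. cocycle r (face (Cq_flag q \<alpha> S) i xs) * (-1) ^ i)
           = cocycle r (last_face (Cq_flag q \<alpha> S) (modular_aut \<Phi> \<alpha>) xs)"
proof -
  obtain a b c d where xs_eq: "xs = [a, b, c, d]"
    using xs by (auto simp: hlists_def length_Suc_conv numeral_3_eq_3)
  have mem: "x \<in> carrier (Cq_flag q \<alpha> S)" if "x \<in> {a, b, c, d}" for x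
    using xs that by (auto simp: hlists_def xs_eq)
  have K: "x (gK r) = x 1" "x (gKinv r) = x 1" if "x \<in> {a, b, c, d}" for x
    using flag_apply_torus[OF mem[OF that], of "[GenK r]"]
      flag_apply_torus[OF mem[OF that], of "[GenKinv r]"] by auto
  have th: "modular_aut \<Phi> \<alpha> d 1 = d 1"
    using modular_aut_one[OF mem[of d]] by simp
  have m: "monoid.mult (Cq_flag q \<alpha> S) = fmult"
    by (simp add: Cq_flag_def)
  show ?thesis
    by (simp add: xs_eq cocycle_def face_def last_face_def m fmult_one fmult_gE fmult_gF K th
        numeral_3_eq_3 lessThan_Suc numeral_2_eq_2 algebra_simps)
qed

lemma pairing_cocycle_hboundary:
  assumes "c \<in> hchains (Cq_flag q \<alpha> S) 3"
  shows "pairing (cocycle r) (hboundary (Cq_flag q \<alpha> S) (modular_aut \<Phi> \<alpha>) 3 c) = 0"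
proof -
  let ?A = "Cq_flag q \<alpha> S" and ?\<sigma> = "modular_aut \<Phi> \<alpha>"
  have "pairing (cocycle r) ((\<Sum>i<3. Poly_Mapping.single (face ?A i xs) ((-1) ^ i))
          + Poly_Mapping.single (last_face ?A ?\<sigma> xs) ((-1) ^ 3)) = 0"
    if "xs \<in> Poly_Mapping.keys c" for xs
    using cocycle_face_sum[of xs q \<alpha> S r \<Phi>] that assms
    by (auto simp: hchains_def pairing_add pairing_sum mult.commute)
  then show ?thesis
    unfolding hboundary_def by (simp add: pairing_lin_ext pairing_def[of _ c])
qed

text \<open>The first two families of relations are killed by multilinearity. The degenerate lists
  are killed because the counit vanishes at \<open>gE r\<close> and \<open>gF r\<close>, the
  arguments of slots 1 and 2.\<close>

lemma pairing_cocycle_null_chains: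
  fixes \<alpha> :: "'i::finite \<Rightarrow> 'a::euclidean_space"
  assumes "c \<in> null_chains (Cq_flag q \<alpha> S) 2"
  shows "pairing (cocycle (r :: 'i)) c = 0"
proof -
  interpret M: Modules.module pscale by (rule module_pscale)
  \<comment> \<open>The three possible positions of the slot that a relation alters.\<close>
  have len3: "length xs + length ys = 2 \<Longrightarrow>
      (\<exists>a b. xs = [] \<and> ys = [a, b]) \<or> (\<exists>a b. xs = [a] \<and> ys = [b]) \<or> (\<exists>a b. xs = [a, b] \<and> ys = [])"
    for xs ys :: "'i functional list"
    by (cases xs; cases "tl xs") (auto simp: length_Suc_conv numeral_2_eq_2)
  have rel: "pairing (cocycle r) x = 0" if "x \<in> tensor_relations (Cq_flag q \<alpha> S) 2" for x
    using that unfolding tensor_relations_def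
  proof (elim UnE)
    assume "x \<in> {Poly_Mapping.single (xs @ (y \<oplus>\<^bsub>Cq_flag q \<alpha> S\<^esub> z) # ys) 1
        - Poly_Mapping.single (xs @ y # ys) 1 - Poly_Mapping.single (xs @ z # ys) 1 | xs y z ys.
        xs @ y # ys \<in> hlists (Cq_flag q \<alpha> S) 2 \<and> z \<in> carrier (Cq_flag q \<alpha> S)}"
    then obtain xs y z ys where "x = Poly_Mapping.single (xs @ (\<lambda>X. y X + z X) # ys) 1
        - Poly_Mapping.single (xs @ y # ys) 1 - Poly_Mapping.single (xs @ z # ys) 1"
      "length xs + length ys = 2"
      by (force simp: hlists_def Cq_flag_def)
    then show ?thesis
      using len3[of xs ys] by (auto simp: pairing_diff cocycle_def ring_distribs)
  next
    assume "x \<in> {Poly_Mapping.single (xs @ (c \<odot>\<^bsub>Cq_flag q \<alpha> S\<^esub> y) # ys) 1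
        - Poly_Mapping.single (xs @ y # ys) c | xs c y ys.
        xs @ y # ys \<in> hlists (Cq_flag q \<alpha> S) 2}"
    then obtain xs c y ys where "x = Poly_Mapping.single (xs @ (\<lambda>X. c * y X) # ys) 1
        - Poly_Mapping.single (xs @ y # ys) c" "length xs + length ys = 2"
      by (force simp: hlists_def Cq_flag_def)
    then show ?thesis
      using len3[of xs ys] by (auto simp: pairing_diff cocycle_def)
  next
    assume "x \<in> {Poly_Mapping.single (m # xs @ \<one>\<^bsub>Cq_flag q \<alpha> S\<^esub> # ys) 1 | m xs ys.
        m # xs @ \<one>\<^bsub>Cq_flag q \<alpha> S\<^esub> # ys \<in> hlists (Cq_flag q \<alpha> S) 2}"
    then obtain m xs ys where "x = Poly_Mapping.single (m # xs @ counit # ys) 1"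
      "length xs + length ys = 1"
      by (auto simp: hlists_def Cq_flag_def)
    then show ?thesis
      by (auto simp: add_is_1 cocycle_def length_Suc_conv counit_gen_word)
  qed
  show ?thesis
    using assms unfolding null_chains_def
    by (induction rule: M.span_induct_alt) (auto simp: pairing_add pairing_pscale rel)
qed

text \<open>The unit of the quotient is the subgroup of boundaries itself. If the coset of
  \<open>c\<close> equals it, then \<open>c\<close> = 0 + \<open>c\<close> is a boundary modulo null
  chains, and the cocycle vanishes there.\<close>

lemma HH_class_nonzero:
  assumes "pairing (cocycle r) c \<noteq> 0"
  shows "HH_class (Cq_flag q \<alpha> S) (modular_aut \<Phi> \<alpha>) 2 c \<noteq>
    \<one>\<^bsub>HH (Cq_flag q \<alpha> S) (modular_aut \<Phi> \<alpha>) 2\<^esub>"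
proof
  let ?B = "hboundaries (Cq_flag q \<alpha> S) (modular_aut \<Phi> \<alpha>) 2"
  interpret M: Modules.module pscale by (rule module_pscale)
  assume "HH_class (Cq_flag q \<alpha> S) (modular_aut \<Phi> \<alpha>) 2 c =
    \<one>\<^bsub>HH (Cq_flag q \<alpha> S) (modular_aut \<Phi> \<alpha>) 2\<^esub>"
  then have eq: "(\<Union>h\<in>?B. {h + c}) = ?B"
    by (simp add: HH_class_def HH_def FactGroup_def r_coset_def cycle_group_def)
  have "0 \<in> ?B"
    unfolding hboundaries_def null_chains_def hboundary_def
    by (auto intro!: exI[of _ 0] M.span_zero simp: hchains_def lin_ext_def)
  then have "c \<in> ?B"
    using eq by force
  then have "pairing (cocycle r) c = 0"
    unfolding hboundaries_def
    by (auto simp: pairing_add pairing_cocycle_null_chains pairing_cocycle_hboundary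
        simp flip: numeral_3_eq_3)
  with assms show False ..
qed


section \<open>Completeness of orthonormal families\<close>

lemma inner_product_on_expand:
  assumes "inner_product_on n B" "u \<in> carrier_vec n" "w \<in> carrier_vec n"
  shows "B u w = (\<Sum>l<n. w $ l * B u (unit_vec n l))"
proof -
  have add: "B u (x + y) = B u x + B u y" if "x \<in> carrier_vec n" "y \<in> carrier_vec n" for x y
    using assms(1,2) that unfolding inner_product_on_def by blast
  have scale: "B u (c \<cdot>\<^sub>v x) = c * B u x" if "x \<in> carrier_vec n" for x c
    using assms(1,2) that unfolding inner_product_on_def by blast
  \<comment> \<open>Induction on the number \<open>m\<close> of coordinates kept in a truncation of
    \<open>w\<close>, since \<open>inner_product_on\<close> provides additivity for two summands at
    a time.\<close>
  have partial: "B u (vec n (\<lambda>l. if l < m then w $ l else 0)) = (\<Sum>l<m. w $ l * B u (unit_vec n l))"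
    if "m \<le> n" for m
    using that
  proof (induction m)
    case 0
    have "vec n (\<lambda>l. 0) = (0::complex) \<cdot>\<^sub>v 0\<^sub>v n"
      by auto
    then show ?case
      using scale[of "0\<^sub>v n" 0] by simp
  next
    case (Suc m)
    have "vec n (\<lambda>l. if l < Suc m then w $ l else 0) =
        vec n (\<lambda>l. if l < m then w $ l else 0) + w $ m \<cdot>\<^sub>v unit_vec n m"
      by (rule eq_vecI) (auto simp: unit_vec_def less_Suc_eq)
    then show ?case
      using Suc by (simp add: add scale)
  qed
  have "vec n (\<lambda>l. if l < n then w $ l else 0) = w"
    using assms(3) by (intro eq_vecI) auto
  then show ?thesis
    using partial[of n] by simp
qed

text \<open>The matrix \<open>C\<close> sends a vector to its coefficients against the family, and
  \<open>M\<close> has the family as columns. Orthonormality says \<open>C * M = 1\<close>; for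
  square matrices this forces \<open>M * C = 1\<close>, so \<open>C\<close> is injective.\<close>

lemma orthonormal_complete:
  assumes B: "inner_product_on n B"
    and v: "\<And>i. i < n \<Longrightarrow> v i \<in> carrier_vec n"
    and orth: "\<And>i j. i < n \<Longrightarrow> j < n \<Longrightarrow> B (v i) (v j) = (if i = j then 1 else 0)"
    and w: "w \<in> carrier_vec n" "\<And>i. i < n \<Longrightarrow> B (v i) w = 0"
  shows "w = 0\<^sub>v n"
proof -
  define C where "C = mat n n (\<lambda>(i, l). B (v i) (unit_vec n l))"
  define M where "M = mat n n (\<lambda>(l, j). v j $ l)"
  have dims: "C \<in> carrier_mat n n" "M \<in> carrier_mat n n"
    by (auto simp: C_def M_def)
  have Cu: "(\<Sum>l<n. B (v i) (unit_vec n l) * u $ l) = B (v i) u"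
    if "i < n" "u \<in> carrier_vec n" for i u
    using inner_product_on_expand[OF B v[OF that(1)] that(2)] by (simp add: mult.commute)
  have "C * M = 1\<^sub>m n"
  proof (rule eq_matI)
    fix i j assume "i < dim_row (1\<^sub>m n :: complex mat)" "j < dim_col (1\<^sub>m n :: complex mat)"
    then have ij: "i < n" "j < n"
      by simp_all
    then have "(C * M) $$ (i, j) = (\<Sum>l<n. B (v i) (unit_vec n l) * v j $ l)"
      by (simp add: C_def M_def scalar_prod_def atLeast0LessThan)
    also have "\<dots> = (1\<^sub>m n :: complex mat) $$ (i, j)"
      unfolding Cu[OF ij(1) v[OF ij(2)]] using ij orth by simp
    finally show "(C * M) $$ (i, j) = 1\<^sub>m n $$ (i, j)" .
  qed (use dims in auto)
  then have "M * C = 1\<^sub>m n"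
    using mat_mult_left_right_inverse dims by blast
  moreover have "C *\<^sub>v w = 0\<^sub>v n"
  proof (rule eq_vecI)
    fix i assume "i < dim_vec (0\<^sub>v n :: complex vec)"
    then have i: "i < n"
      by simp
    then have "(C *\<^sub>v w) $ i = (\<Sum>l<n. B (v i) (unit_vec n l) * w $ l)"
      using w(1) by (simp add: C_def scalar_prod_def atLeast0LessThan)
    then show "(C *\<^sub>v w) $ i = 0\<^sub>v n $ i"
      unfolding Cu[OF i w(1)] using i w(2) by simp
  qed (use dims in auto)
  ultimately have "1\<^sub>m n *\<^sub>v w = M *\<^sub>v 0\<^sub>v n"
    using dims w(1) by (metis assoc_mult_mat_vec)
  then show ?thesis
    using w(1) dims by auto
qed

section \<open>Fundamental weights\<close>

text \<open>The definite description needs existence and uniqueness. Existence: a linear form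
  prescribed on the independent simple roots is represented by the vector
  \<open>adjoint g 1\<close>. Uniqueness: the simple roots span, as every root is up to sign a
  combination of them.\<close>

lemma fundamental_weight_pairing:
  fixes \<alpha> :: "'i::finite \<Rightarrow> 'a::euclidean_space"
  assumes "simple_lie_data \<Phi> \<alpha>"
  shows "2 * inner (fundamental_weight \<alpha> i) (\<alpha> j) / inner (\<alpha> j) (\<alpha> j) = (if i = j then 1 else 0)"
proof -
  have inj: "inj \<alpha>" and ind: "independent (range \<alpha>)"
    using assms by (auto simp: simple_lie_data_def)
  have nz: "\<alpha> j \<noteq> 0" for j
    using ind dependent_zero by (metis rangeI)
  have comb: "(\<Sum>i\<in>UNIV. real (n i) *\<^sub>R \<alpha> i) \<in> span (range \<alpha>)" for n
    by (intro span_sum span_scale span_base) auto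
  have "\<beta> \<in> span (range \<alpha>)" if "\<beta> \<in> \<Phi>" for \<beta>
  proof -
    have "\<beta> \<in> positive_roots \<Phi> \<alpha> \<or> - \<beta> \<in> positive_roots \<Phi> \<alpha>"
      using assms that by (auto simp: simple_lie_data_def)
    then have "\<beta> \<in> span (range \<alpha>) \<or> - \<beta> \<in> span (range \<alpha>)"
      using comb by (auto simp: positive_roots_def)
    then show ?thesis
      using span_neg by fastforce
  qed
  then have "span \<Phi> \<subseteq> span (range \<alpha>)"
    by (intro span_minimal) auto
  then have span: "span (range \<alpha>) = UNIV"
    using assms by (auto simp: simple_lie_data_def irreducible_root_system_def)
  obtain g :: "'a \<Rightarrow> real" where g: "linear g"
      "\<forall>x\<in>range \<alpha>. g x = (if x = \<alpha> i then inner (\<alpha> i) (\<alpha> i) / 2 else 0)"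
    using linear_independent_extend[OF ind,
        of "\<lambda>x. if x = \<alpha> i then inner (\<alpha> i) (\<alpha> i) / 2 else 0"] by blast
  define w where "w = adjoint g 1"
  have w: "inner w x = g x" for x
    using adjoint_works[OF g(1), of x 1] by (simp add: w_def inner_commute)
  let ?P = "\<lambda>w :: 'a. \<forall>j. 2 * inner w (\<alpha> j) / inner (\<alpha> j) (\<alpha> j) = (if i = j then 1 else 0)"
  have Pw: "?P w"
    using g(2) nz inj by (auto simp: w inj_eq)
  have "w' = w" if "?P w'" for w'
  proof -
    have "inner w' (\<alpha> j) = inner w (\<alpha> j)" for j
    proof -
      have "2 * inner w' (\<alpha> j) / inner (\<alpha> j) (\<alpha> j) = 2 * inner w (\<alpha> j) / inner (\<alpha> j) (\<alpha> j)"
        using that Pw by simp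
      then show ?thesis
        using nz[of j] by simp
    qed
    then have "orthogonal (w' - w) x" if "x \<in> range \<alpha>" for x
      using that by (auto simp: orthogonal_def inner_diff_left)
    then have "orthogonal (w' - w) (w' - w)"
      using orthogonal_to_span[of "w' - w" "range \<alpha>" "w' - w"] span by simp
    then show ?thesis
      by (simp add: orthogonal_def)
  qed
  then have "?P (fundamental_weight \<alpha> i)"
    unfolding fundamental_weight_def by (rule theI[where P = ?P, OF Pw])
  then show ?thesis
    by blast
qed

text \<open>Among the summands of \<open>rho_sub \<alpha> S\<close> only the fundamental weight of
  \<open>r\<close> pairs nontrivially with \<open>\<alpha> r\<close>, and it is present because
  \<open>r\<close> lies outside \<open>S\<close>.\<close>

lemma inner_rho_sub_pos:
  assumes "simple_lie_data \<Phi> \<alpha>" "r \<notin> S"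
  shows "inner (rho_sub \<alpha> S) (\<alpha> r) > 0"
proof -
  have "\<alpha> r \<noteq> 0"
    using assms(1) dependent_zero by (metis rangeI simple_lie_data_def)
  then have pos: "inner (\<alpha> r) (\<alpha> r) > 0"
    by simp
  then have "inner (fundamental_weight \<alpha> i) (\<alpha> r) = (if i = r then inner (\<alpha> r) (\<alpha> r) / 2 else 0)" for i
    using fundamental_weight_pairing[OF assms(1), of i r] by (auto simp: field_simps split: if_splits)
  then have "inner (rho_sub \<alpha> S) (\<alpha> r) = inner (\<alpha> r) (\<alpha> r) / 2"
    using assms(2) by (simp add: rho_sub_def inner_sum_left)
  with pos show ?thesis
    by linarith
qed

section \<open>Representations and highest weight vectors\<close>

lemma Uq_rep_relation:
  assumes "Uq_rep q \<alpha> n \<pi>" "X - Y \<in> Uq_relations q \<alpha>"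
  shows "\<pi> X = \<pi> Y"
proof -
  interpret M: Modules.module pscale by (rule module_pscale)
  \<comment> \<open>Units on both sides give the relation the shape of a spanning element of the
    ideal.\<close>
  have "1 * (X - Y) * 1 \<in> Uq_ideal q \<alpha>"
    unfolding Uq_ideal_def using assms(2) by (intro M.span_base) blast
  then have "\<pi> (X - Y) = 0\<^sub>m n n" "\<pi> Y \<in> carrier_mat n n"
    using assms(1) by (auto simp: Uq_rep_def)
  moreover have "\<pi> X = \<pi> (X - Y) + \<pi> Y"
    using assms(1) unfolding Uq_rep_def by (metis diff_add_cancel)
  ultimately show ?thesis
    by simp
qed

lemma Uq_rep_uminus_mult_vec:
  assumes "Uq_rep q \<alpha> n \<pi>" "u \<in> carrier_vec n"
  shows "\<pi> (- X) *\<^sub>v u = - (\<pi> X *\<^sub>v u)"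
proof -
  have "- X = pscale (- 1) X"
    by (simp add: pscale_uminus)
  then have "\<pi> (- X) = - 1 \<cdot>\<^sub>m \<pi> X" and "\<pi> X \<in> carrier_mat n n"
    using assms(1) unfolding Uq_rep_def by metis+
  then show ?thesis
    using assms(2) by (auto simp: scalar_prod_def sum_negf)
qed

lemma Uq_rep_gen_word_Cons:
  assumes "Uq_rep q \<alpha> n \<pi>" "u \<in> carrier_vec n"
  shows "\<pi> (gen_word (g # gs)) *\<^sub>v u = \<pi> (gen_word [g]) *\<^sub>v (\<pi> (gen_word gs) *\<^sub>v u)"
proof -
  have "gen_word (g # gs) = gen_word [g] * gen_word gs"
    by simp
  then show ?thesis
    using assms unfolding Uq_rep_def by (metis assoc_mult_mat_vec)
qed

lemma Uq_rep_gKinv_gK: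
  assumes "Uq_rep q \<alpha> n \<pi>" "u \<in> carrier_vec n"
  shows "\<pi> (gKinv i) *\<^sub>v (\<pi> (gK i) *\<^sub>v u) = u"
proof -
  have "gKinv i * gK i - 1 \<in> Uq_relations q \<alpha>"
    unfolding Uq_relations_def by blast
  from Uq_rep_relation[OF assms(1) this] have "\<pi> (gen_word [GenKinv i, GenK i]) = 1\<^sub>m n"
    using assms(1) by (simp add: Uq_rep_def)
  then show ?thesis
    using Uq_rep_gen_word_Cons[OF assms, of "GenKinv i" "[GenK i]"] assms(2) by simp
qed

lemma smult_mat_mult_vec:
  fixes c :: "'a :: comm_ring_1"
  assumes "A \<in> carrier_mat m n" "u \<in> carrier_vec n"
  shows "(c \<cdot>\<^sub>m A) *\<^sub>v u = c \<cdot>\<^sub>v (A *\<^sub>v u)"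
  by (rule eq_vecI) (use assms in \<open>auto simp: smult_scalar_prod_distrib[of _ n]\<close>)

text \<open>Apply the commutator relation of \<open>gE r\<close> and \<open>gF r\<close> to
  \<open>u\<close>: the term with \<open>gE r\<close> acting first vanishes, and the torus part acts
  by a scalar.\<close>

lemma highest_weight_gE_gF:
  assumes \<pi>: "Uq_rep q \<alpha> n \<pi>" and u: "highest_weight_vector q \<alpha> n \<pi> \<mu> u" and "0 < q"
  shows "\<pi> (gE r) *\<^sub>v (\<pi> (gF r) *\<^sub>v u) = complex_of_real
    ((q powr inner \<mu> (\<alpha> r) - inverse (q powr inner \<mu> (\<alpha> r))) / (qi q \<alpha> r - inverse (qi q \<alpha> r))) \<cdot>\<^sub>v u"
proof -
  define k where "k = complex_of_real (q powr inner \<mu> (\<alpha> r))"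
  define c where "c = complex_of_real (1 / (qi q \<alpha> r - inverse (qi q \<alpha> r)))"
  have uc: "u \<in> carrier_vec n" and K: "\<pi> (gK r) *\<^sub>v u = k \<cdot>\<^sub>v u" and E: "\<pi> (gE r) *\<^sub>v u = 0\<^sub>v n"
    using u by (auto simp: highest_weight_vector_def weight_vector_def k_def)
  have "k \<noteq> 0"
    using \<open>0 < q\<close> by (simp add: k_def)
  have dim: "\<pi> X \<in> carrier_mat n n" for X
    using \<pi> by (simp add: Uq_rep_def)
  have "u = \<pi> (gKinv r) *\<^sub>v (k \<cdot>\<^sub>v u)"
    using Uq_rep_gKinv_gK[OF \<pi> uc, of r] by (simp add: K)
  also have "\<dots> = k \<cdot>\<^sub>v (\<pi> (gKinv r) *\<^sub>v u)"
    by (rule mult_mat_vec[OF dim uc])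
  finally have "inverse k \<cdot>\<^sub>v u = inverse k \<cdot>\<^sub>v (k \<cdot>\<^sub>v (\<pi> (gKinv r) *\<^sub>v u))"
    by simp
  then have Kinv: "\<pi> (gKinv r) *\<^sub>v u = inverse k \<cdot>\<^sub>v u"
    using \<open>k \<noteq> 0\<close> by (simp add: smult_smult_assoc)
  have "gE r * gF r - gF r * gE r - pscale c (gK r - gKinv r) \<in> Uq_relations q \<alpha>"
    unfolding Uq_relations_def c_def by (intro UnI1 UnI2) force
  \<comment> \<open>Differences are rewritten as sums with a factor -1, because
    \<open>Uq_rep\<close> speaks of sums, products and scalings.\<close>
  then have "\<pi> (gE r * gF r) = \<pi> (gF r * gE r + pscale c (gK r + pscale (- 1) (gKinv r)))"
    using Uq_rep_relation[OF \<pi>] by (simp add: diff_diff_eq pscale_uminus)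
  also have "\<dots> = \<pi> (gF r) * \<pi> (gE r) + c \<cdot>\<^sub>m (\<pi> (gK r) + (- 1) \<cdot>\<^sub>m \<pi> (gKinv r))"
    using \<pi> by (simp only: Uq_rep_def)
  finally have "\<pi> (gE r) * \<pi> (gF r) =
      \<pi> (gF r) * \<pi> (gE r) + c \<cdot>\<^sub>m (\<pi> (gK r) + (- 1) \<cdot>\<^sub>m \<pi> (gKinv r))"
    using \<pi> by (simp only: Uq_rep_def)
  then have "\<pi> (gE r) *\<^sub>v (\<pi> (gF r) *\<^sub>v u) =
      (\<pi> (gF r) * \<pi> (gE r) + c \<cdot>\<^sub>m (\<pi> (gK r) + (- 1) \<cdot>\<^sub>m \<pi> (gKinv r))) *\<^sub>v u"
    using dim uc by (metis assoc_mult_mat_vec)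
  also have "\<dots> = \<pi> (gF r) *\<^sub>v (\<pi> (gE r) *\<^sub>v u)
      + c \<cdot>\<^sub>v (\<pi> (gK r) *\<^sub>v u + (- 1) \<cdot>\<^sub>v (\<pi> (gKinv r) *\<^sub>v u))"
    using dim uc by (simp add: add_mult_distrib_mat_vec[of _ n n] smult_mat_mult_vec[of _ n n]
        assoc_mult_mat_vec[of _ n n _ n] mult_carrier_mat[OF dim dim])
  also have "\<dots> = (c * (k - inverse k)) \<cdot>\<^sub>v u"
    using dim[of "gF r"] uc by (auto simp: E K Kinv algebra_simps)
  finally show ?thesis
    by (simp add: c_def k_def)
qed

text \<open>Otherwise applying \<open>gE r\<close> would give 0, whereas it gives a nonzero multiple
  of \<open>u\<close>: the numerator and denominator of the scalar both have the form x - 1/x with 0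
  < x < 1.\<close>

lemma highest_weight_gF_nonzero:
  assumes "Uq_rep q \<alpha> n \<pi>" "highest_weight_vector q \<alpha> n \<pi> \<mu> u" "0 < q" "q < 1"
    and pos: "inner \<mu> (\<alpha> r) > 0" "\<alpha> r \<noteq> 0"
  shows "\<pi> (gF r) *\<^sub>v u \<noteq> 0\<^sub>v n"
proof
  have u: "u \<in> carrier_vec n" "u \<noteq> 0\<^sub>v n"
    using assms(2) by (auto simp: highest_weight_vector_def weight_vector_def)
  have ne: "x - inverse x \<noteq> 0" if "0 < x" "x < 1" for x :: real
    using that one_less_inverse[of x] by linarith
  define c where "c = complex_of_real ((q powr inner \<mu> (\<alpha> r) - inverse (q powr inner \<mu> (\<alpha> r)))
    / (qi q \<alpha> r - inverse (qi q \<alpha> r)))"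
  have lt: "q powr x < 1" if "x > 0" for x
    using that \<open>0 < q\<close> \<open>q < 1\<close> by (simp add: powr01_less_one)
  have "c \<noteq> 0"
    unfolding c_def qi_def of_real_eq_0_iff using pos \<open>0 < q\<close> ne[of "q powr _", OF _ lt] by simp
  assume "\<pi> (gF r) *\<^sub>v u = 0\<^sub>v n"
  then have "\<pi> (gE r) *\<^sub>v 0\<^sub>v n = c \<cdot>\<^sub>v u"
    using highest_weight_gE_gF[OF assms(1-3), of r] by (simp only: c_def)
  moreover have carr: "\<pi> (gE r) \<in> carrier_mat n n"
    using assms(1) by (simp add: Uq_rep_def)
  have "\<pi> (gE r) *\<^sub>v 0\<^sub>v n = 0\<^sub>v n"
    by (rule eq_vecI) (use carr in auto)
  ultimately have "0\<^sub>v n = c \<cdot>\<^sub>v u"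
    by simp
  then have "inverse c \<cdot>\<^sub>v (c \<cdot>\<^sub>v u) = 0\<^sub>v n"
    by (auto simp flip: \<open>0\<^sub>v n = c \<cdot>\<^sub>v u\<close>)
  then show False
    using u \<open>c \<noteq> 0\<close> by (simp add: smult_smult_assoc)
qed

section \<open>The value of the cocycle on C(P_1)\<close>

lemma mcoeff_apply: "mcoeff \<pi> B v i j X = B (v i) (\<pi> X *\<^sub>v v j)"
  by (simp add: mcoeff_def)

lemma fstar_mcoeff: "fstar (mcoeff \<pi> B v j 0) X = cnj (B (v j) (\<pi> (star (antip X)) *\<^sub>v v 0))"
  by (simp add: fstar_def mcoeff_apply)

lemma inner_product_on_simps:
  assumes "inner_product_on n B" "u \<in> carrier_vec n"
  shows "B u (0\<^sub>v n) = 0" "w \<in> carrier_vec n \<Longrightarrow> B u (- w) = - B u w"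
  using assms inner_product_on_expand[OF assms] by (auto simp: sum_negf)

text \<open>In each Leibniz expansion one term dies because \<open>gE r\<close> kills
  \<open>v 0\<close>: for \<open>gE r\<close> it is the term differentiating the first factor, for
  \<open>gF r\<close> the one differentiating the starred factor. The surviving undifferentiated
  factor is a Kronecker delta.\<close>

lemma proj_entry_values:
  assumes \<pi>: "Uq_rep q \<alpha> n \<pi>" and B: "inner_product_on n B"
    and v: "\<And>i. i < n \<Longrightarrow> v i \<in> carrier_vec n"
    and orth: "\<And>i j. i < n \<Longrightarrow> j < n \<Longrightarrow> B (v i) (v j) = (if i = j then 1 else 0)"
    and hw: "highest_weight_vector q \<alpha> n \<pi> \<mu> (v 0)"
    and ij: "0 < n" "i < n" "j < n"
  shows "proj_entry \<pi> B v i j 1 = (if i = 0 \<and> j = 0 then 1 else 0)"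
    and "proj_entry \<pi> B v i j (gE r) = (if i = 0 then - cnj (B (v j) (\<pi> (gF r) *\<^sub>v v 0)) else 0)"
    and "proj_entry \<pi> B v i j (gF r) = (if j = 0 then B (v i) (\<pi> (gF r) *\<^sub>v v 0) else 0)"
proof -
  have v0: "v 0 \<in> carrier_vec n" and E: "\<pi> (gE r) *\<^sub>v v 0 = 0\<^sub>v n"
    using hw by (auto simp: highest_weight_vector_def weight_vector_def)
  have dim: "\<pi> X \<in> carrier_mat n n" for X
    using \<pi> by (simp add: Uq_rep_def)
  then have cv: "\<pi> X *\<^sub>v u \<in> carrier_vec n" for X u
    by (metis carrier_matD(1) carrier_vecI dim_mult_mat_vec)
  have one: "\<pi> 1 *\<^sub>v v 0 = v 0"
    using \<pi> v0 by (simp add: Uq_rep_def)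
  have sE: "\<pi> (star (antip (gE r))) *\<^sub>v v 0 = - (\<pi> (gF r) *\<^sub>v v 0)"
    by (simp add: star_antip_gE Uq_rep_uminus_mult_vec[OF \<pi>] Uq_rep_gKinv_gK[OF \<pi>] v0 cv
        Uq_rep_gen_word_Cons[OF \<pi>, of _ _ "_ # _"])
  have sF: "\<pi> (star (antip (gF r))) *\<^sub>v v 0 = - 0\<^sub>v n"
    by (simp add: star_antip_gF Uq_rep_uminus_mult_vec[OF \<pi>] Uq_rep_gKinv_gK[OF \<pi>] v0 cv E
        Uq_rep_gen_word_Cons[OF \<pi>, of _ _ "_ # _"])
  note simps = proj_entry_def fmult_one fmult_gE fmult_gF fstar_mcoeff mcoeff_apply star_antip_one
    one sE sF E orth ij inner_product_on_simps[OF B v] cv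
  show "proj_entry \<pi> B v i j 1 = (if i = 0 \<and> j = 0 then 1 else 0)"
    by (simp add: simps)
  show "proj_entry \<pi> B v i j (gE r) = (if i = 0 then - cnj (B (v j) (\<pi> (gF r) *\<^sub>v v 0)) else 0)"
    by (simp add: simps)
  show "proj_entry \<pi> B v i j (gF r) = (if j = 0 then B (v i) (\<pi> (gF r) *\<^sub>v v 0) else 0)"
    by (simp add: simps)
qed

text \<open>The second slot forces \<open>j = 0\<close> and the third forces \<open>i = 0\<close>;
  the first slot is then 2 - 1 = 1. What remains is a weighted sum over \<open>k\<close> of squared
  coefficients of \<open>gF r\<close> applied to \<open>v 0\<close>, with a minus sign from the
  antipode.\<close>

lemma pairing_cocycle_chain_C:
  assumes "Uq_rep q \<alpha> n \<pi>" "inner_product_on n B"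
    and "\<And>i. i < n \<Longrightarrow> v i \<in> carrier_vec n"
    and "\<And>i j. i < n \<Longrightarrow> j < n \<Longrightarrow> B (v i) (v j) = (if i = j then 1 else 0)"
    and "highest_weight_vector q \<alpha> n \<pi> \<mu> (v 0)"
    and n: "0 < n"
  shows "pairing (cocycle r) (chain_C q \<Phi> \<alpha> n wt (proj_entry \<pi> B v)) = complex_of_real
    (- (q powr inner (2 *\<^sub>R rho \<Phi> \<alpha>) (wt 0)) * (\<Sum>k<n. (cmod (B (v k) (\<pi> (gF r) *\<^sub>v v 0)))\<^sup>2))"
proof -
  let ?p = "proj_entry \<pi> B v" and ?f = "\<lambda>k. B (v k) (\<pi> (gF r) *\<^sub>v v 0)"
  let ?c = "\<lambda>i. complex_of_real (q powr inner (2 *\<^sub>R rho \<Phi> \<alpha>) (wt i))"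
  note vals = proj_entry_values[OF assms]
  have "pairing (cocycle r) (chain_C q \<Phi> \<alpha> n wt ?p) =
      (\<Sum>i<n. \<Sum>j<n. \<Sum>k<n. ?c i * cocycle r
        [\<lambda>X. 2 * ?p i j X - (if i = j then 1 else 0) * counit X, ?p j k, ?p k i])"
    by (simp add: chain_C_def pairing_sum)
  also have "\<dots> = (\<Sum>i<n. \<Sum>j<n. \<Sum>k<n. if i = 0 \<and> j = 0 then - ?c 0 * (?f k * cnj (?f k)) else 0)"
    by (intro sum.cong refl) (auto simp: cocycle_def vals counit_one)
  also have "\<dots> = (\<Sum>i<n. \<Sum>j<n. if i = 0 \<and> j = 0 then - ?c 0 * (\<Sum>k<n. ?f k * cnj (?f k)) else 0)"
    by (intro sum.cong refl) (auto simp: sum_distrib_left sum_negf)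
  also have "\<dots> = (\<Sum>i<n. if i = 0 then - ?c 0 * (\<Sum>k<n. ?f k * cnj (?f k)) else 0)"
    by (intro sum.cong refl) (use n in auto)
  also have "\<dots> = - ?c 0 * (\<Sum>k<n. ?f k * cnj (?f k))"
    using n by simp
  finally show ?thesis
    by (simp add: complex_norm_square del: of_real_power)
qed

theorem theorem4p4:
  fixes \<Phi> :: "'a::euclidean_space set"
    and \<alpha> :: "'i::{finite,linorder} \<Rightarrow> 'a"
    and S :: "'i set"
    and q :: real
    and N :: nat
    and \<pi> :: "'i free_alg \<Rightarrow> complex mat"
    and B :: "complex vec \<Rightarrow> complex vec \<Rightarrow> complex"
    and v :: "nat \<Rightarrow> complex vec"
    and wt :: "nat \<Rightarrow> 'a"
  assumes "simple_lie_data \<Phi> \<alpha>"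
    and "0 < q" and "q < 1"
    and "S \<subset> UNIV"
    and "is_V q \<alpha> (rho_sub \<alpha> S) N \<pi>"
    and "invariant_inner_product N \<pi> B"
    and "\<And>i. i < N \<Longrightarrow> weight_vector q \<alpha> N \<pi> (wt i) (v i)"
    and "\<And>i j. i < N \<Longrightarrow> j < N \<Longrightarrow> B (v i) (v j) = (if i = j then 1 else 0)"
    and "highest_weight_vector q \<alpha> N \<pi> (rho_sub \<alpha> S) (v 0)"
  shows "HH_class (Cq_flag q \<alpha> S) (modular_aut \<Phi> \<alpha>) 2
           (chain_C q \<Phi> \<alpha> N wt (proj_entry \<pi> B v))
         \<noteq> \<one>\<^bsub>HH (Cq_flag q \<alpha> S) (modular_aut \<Phi> \<alpha>) 2\<^esub>"
proof -
  \<comment> \<open>Properness of \<open>S\<close> enters here: it supplies the simple root that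
    defines the cocycle.\<close>
  obtain r where "r \<notin> S"
    using assms(4) by blast
  have rep: "Uq_rep q \<alpha> N \<pi>" and N: "0 < N"
    using assms(5) by (auto simp: is_V_def irreducible_rep_def)
  have B: "inner_product_on N B"
    using assms(6) by (simp add: invariant_inner_product_def)
  have v: "v i \<in> carrier_vec N" if "i < N" for i
    using assms(7)[OF that] by (simp add: weight_vector_def)
  let ?w = "\<pi> (gF r) *\<^sub>v v 0"
  have pos: "inner (rho_sub \<alpha> S) (\<alpha> r) > 0"
    by (rule inner_rho_sub_pos[OF assms(1) \<open>r \<notin> S\<close>])
  then have "\<alpha> r \<noteq> 0"
    by auto
  with pos have "?w \<noteq> 0\<^sub>v N"
    by (intro highest_weight_gF_nonzero[OF rep assms(9,2,3)])
  moreover have "?w \<in> carrier_vec N"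
    using rep by (metis Uq_rep_def carrier_matD(1) carrier_vecI dim_mult_mat_vec)
  \<comment> \<open>A nonzero vector cannot be orthogonal to the whole basis, so at least one square
    in the sum is positive.\<close>
  ultimately obtain k where "k < N" "B (v k) ?w \<noteq> 0"
    using orthonormal_complete[OF B v assms(8)] by blast
  then have "(\<Sum>k<N. (cmod (B (v k) ?w))\<^sup>2) > 0"
    by (intro sum_pos2[of _ k]) auto
  then have "- (q powr inner (2 *\<^sub>R rho \<Phi> \<alpha>) (wt 0)) * (\<Sum>k<N. (cmod (B (v k) ?w))\<^sup>2) \<noteq> 0"
    using \<open>0 < q\<close> by simp
  moreover have "pairing (cocycle r) (chain_C q \<Phi> \<alpha> N wt (proj_entry \<pi> B v)) = complex_of_real
      (- (q powr inner (2 *\<^sub>R rho \<Phi> \<alpha>) (wt 0)) * (\<Sum>k<N. (cmod (B (v k) ?w))\<^sup>2))"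
    by (rule pairing_cocycle_chain_C[OF rep B v assms(8,9) N])
  ultimately have "pairing (cocycle r) (chain_C q \<Phi> \<alpha> N wt (proj_entry \<pi> B v)) \<noteq> 0"
    by (metis of_real_eq_0_iff)
  then show ?thesis
    by (rule HH_class_nonzero)
qed

end
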